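(* Let $G$ be a context-free grammar, $p$ a program, $s\sqsubseteq p$ a code fragment of $p$, and $s'$ a patched program of $s$ regarding $p$ via LCA-based syntactic patching. If any two statements $n_1$ and $n_2$ in $s'$ have the same partial order in $s'$ and in $p$ (that is, $n_1<n_2$ with respect to the control flow graph of $s'$ if and only if $n_1<n_2$ with respect to the control flow graph of $p$, and likewise with $n_1,n_2$ exchanged), then any path in $s'$ is a subsequence of some path in $p$; i.e., for every path $t$ in $s'$ there exists a path $\omega$ in $p$ such that $t\sqsubseteq\omega$.
   Context: **Programs and fragments.** A program $p=t_0t_1\ldots t_n$ is a finite sequence of tokens (lexemes) of an imperative programming language (C in the paper) with context-free grammar $G$. Each token has a unique identification given by its location in the program. $|p|$ is the number of tokens of $p$, and $p_1$ is smaller than $p_2$ iff $|p_1|<|p_2|$. A program $q=t'_0\ldots t'_m$ is a code fragment of $p$, written $q\sqsubseteq p$, iff $t'_0\ldots t'_m$ is a subsequence (not necessarily contiguous) of $t_0\ldots t_n$. Because tokens are identified by location, tokens and statements of $s'\sqsubseteq p$ are identified with the corresponding tokens and statements of $p$. $parse(p,G)$ denotes the parse tree of $p$ under $G$. **LCA relation.** The lowest common ancestor (LCA) of two nodes $x,y$ of a tree is the common ancestor of $x$ and $y$ that is not an ancestor of any other common ancestor of $x$ and $y$. The LCA relation of two nodes $x,y$ on a parse tree $pt$ is the 4-tuple $R_{lca}(x,y,pt)=(L,r,i_x,i_y)$, where $L$ is the LCA of $x$ and $y$ (a non-terminal node of $pt$), $r$ is the right-hand side of the production rule applied at $L$ (whose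 left-hand side is $L$), $i_x$ is the position in $r$ of the ancestor of $x$, and $i_y$ is the position in $r$ of the ancestor of $y$. **LCA-based syntactic patching.** Given a context-free grammar $G$, a program $p$, and a code fragment $s\sqsubseteq p$, $s'$ is a patched program of $s$ regarding $p$ (via LCA-based syntactic patching) iff (1) $s'\sqsubseteq p$; (2) $s\sqsubseteq s'$; (3) $s'$ is recognized by $G$; (4) for all tokens $x,y\in s$, $R_{lca}(x,y,parse(p,G))=R_{lca}(x,y,parse(s',G))$; and (5) $s'$ is the smallest program satisfying (1)--(4). **Partial order and paths.** The partial order is defined on two nodes (statements) of the control flow graph of a program: $x_1$ is ordered before $x_2$, written $x_1<x_2$, iff along some acyclic path of the control flow graph $x_1$ is a predecessor of $x_2$. If $x_1$ and $x_2$ do not appear together on any acyclic path, they do not have an order. A path in a program is a path in its control flow graph, regarded as a sequence of statements; for paths, $t\sqsubseteq\omega$ means that $t$ is a (not necessarily contiguous) subsequence of $\omega$.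
   Formalization: Control flow graphs are assumed to have no self-loops (no edge from a statement to itself); the partial order on acyclic paths cannot see such edges, and the claim fails if a statement has a self-loop in s' but lies on no cycle in p. *)

theory Defs
  imports "HOL-Library.Sublist" "Graph_Theory.Graph_Theory"
begin

section \<open>Programs and context-free grammars\<close>

text \<open>
  A token is a terminal symbol together with the location that identifies it. Fragments keep the
  locations of their tokens, so \<open>s\<close> is a code fragment of \<open>p\<close> iff \<^term>\<open>subseq s p\<close>.
\<close>

type_synonym 't token = "nat \<times> 't"
type_synonym 't program = "'t token list"

definition unique_locations :: "'t program \<Rightarrow> bool" where
  "unique_locations p \<longleftrightarrow> distinct (map fst p)"

datatype ('n, 't) symbol = NT 'n | T 't

record ('n, 't) grammar =
  start :: 'n
  productions :: "('n \<times> ('n, 't) symbol list) set"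

definition context_free_grammar :: "('n, 't) grammar \<Rightarrow> bool" where
  "context_free_grammar G \<longleftrightarrow> finite (productions G)"

datatype ('n, 't) ptree = Leaf "'t token" | Node 'n "('n, 't) ptree list"

fun root :: "('n, 't) ptree \<Rightarrow> ('n, 't) symbol" where
  "root (Leaf x) = T (snd x)"
| "root (Node A ts) = NT A"

fun yield :: "('n, 't) ptree \<Rightarrow> 't program" where
  "yield (Leaf x) = [x]"
| "yield (Node A ts) = concat (map yield ts)"

inductive derivation_tree :: "('n, 't) grammar \<Rightarrow> ('n, 't) ptree \<Rightarrow> bool" for G where
  leaf: "derivation_tree G (Leaf x)"
| node: "(A, map root ts) \<in> productions G \<Longrightarrow> (\<And>t. t \<in> set ts \<Longrightarrow> derivation_tree G t)
    \<Longrightarrow> derivation_tree G (Node A ts)"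

definition is_parse_tree :: "('n, 't) grammar \<Rightarrow> 't program \<Rightarrow> ('n, 't) ptree \<Rightarrow> bool" where
  "is_parse_tree G q pt \<longleftrightarrow> derivation_tree G pt \<and> root pt = NT (start G) \<and> yield pt = q"

definition recognized :: "('n, 't) grammar \<Rightarrow> 't program \<Rightarrow> bool" where
  "recognized G q \<longleftrightarrow> (\<exists>pt. is_parse_tree G q pt)"


section \<open>The LCA relation\<close>

text \<open>
  A node of a tree is represented by its address, the list of child indices (from 0) leading to it
  from the root; the ancestors of a node are then the prefixes of its address.
\<close>

type_synonym address = "nat list"

fun subtree_at :: "('n, 't) ptree \<Rightarrow> address \<Rightarrow> ('n, 't) ptree option" where
  "subtree_at t [] = Some t"
| "subtree_at (Leaf x) (i # a) = None"
| "subtree_at (Node A ts) (i # a) = (if i < length ts then subtree_at (ts ! i) a else None)"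

definition leaf_of :: "('n, 't) ptree \<Rightarrow> 't token \<Rightarrow> address" where
  "leaf_of pt x = (THE a. subtree_at pt a = Some (Leaf x))"

text \<open>
  An LCA is a non-terminal node. For two distinct leaves this is automatic; the LCA of a
  leaf with itself is thereby its parent.
\<close>

definition common_ancestor :: "('n, 't) ptree \<Rightarrow> address \<Rightarrow> address \<Rightarrow> address \<Rightarrow> bool" where
  "common_ancestor pt a b L \<longleftrightarrow>
     (\<exists>A ts. subtree_at pt L = Some (Node A ts)) \<and> prefix L a \<and> prefix L b"

definition lca :: "('n, 't) ptree \<Rightarrow> address \<Rightarrow> address \<Rightarrow> address" where
  "lca pt a b = (THE L. common_ancestor pt a b L \<and>
     \<not> (\<exists>L'. common_ancestor pt a b L' \<and> strict_prefix L L'))"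

definition child_position :: "address \<Rightarrow> address \<Rightarrow> nat" where
  "child_position L a = (THE i. prefix (L @ [i]) a)"

text \<open>
  The relation is compared across different parse trees, so its first component is the non-terminal
  labelling the LCA rather than the address of the LCA.
\<close>

definition R_lca :: "'t token \<Rightarrow> 't token \<Rightarrow> ('n, 't) ptree
    \<Rightarrow> 'n \<times> ('n, 't) symbol list \<times> nat \<times> nat" where
  "R_lca x y pt =
     (let a = leaf_of pt x; b = leaf_of pt y; L = lca pt a b in
      case the (subtree_at pt L) of
        Node A ts \<Rightarrow> (A, map root ts, child_position L a, child_position L b))"


section \<open>LCA-based syntactic patching\<close>

definition patch_candidate ::
  "('n, 't) grammar \<Rightarrow> ('t program \<Rightarrow> ('n, 't) ptree) \<Rightarrow> 't program \<Rightarrow> 't program \<Rightarrow> 't program \<Rightarrow> bool"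
where
  "patch_candidate G parse p s s' \<longleftrightarrow>
     subseq s' p \<and> subseq s s' \<and> recognized G s' \<and>
     (\<forall>x\<in>set s. \<forall>y\<in>set s. R_lca x y (parse p) = R_lca x y (parse s'))"

text \<open>A smallest candidate need not be unique; each of them is a patched program.\<close>

definition patched_program ::
  "('n, 't) grammar \<Rightarrow> ('t program \<Rightarrow> ('n, 't) ptree) \<Rightarrow> 't program \<Rightarrow> 't program \<Rightarrow> 't program \<Rightarrow> bool"
where
  "patched_program G parse p s s' \<longleftrightarrow>
     patch_candidate G parse p s s' \<and>
     (\<forall>q. patch_candidate G parse p s q \<longrightarrow> length s' \<le> length q)"


section \<open>Statements, control flow and paths\<close>

text \<open>
  The statements of a program are the nodes of its parse tree that are labelled by one of the
  non-terminals \<open>S\<close> singled out as statement non-terminals.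
\<close>

definition statements :: "'n set \<Rightarrow> ('n, 't) ptree \<Rightarrow> address set" where
  "statements S pt = {a. \<exists>A ts. subtree_at pt a = Some (Node A ts) \<and> A \<in> S}"

definition statement_tokens :: "('n, 't) ptree \<Rightarrow> address \<Rightarrow> 't token set" where
  "statement_tokens pt a = set (yield (the (subtree_at pt a)))"

text \<open>
  An imperative language consists of a grammar, a parser choosing the parse tree of each program
  (determined by the grammar if that is unambiguous), the statement non-terminals, and the
  assignment of a control flow graph to each program, whose nodes are the statements of the program.
  Nothing is assumed about how the edges arise from the program, except that they join distinct
  statements (part of \<^locale>\<open>pair_digraph\<close>). In C, a loop always passes through its body,
  which is a statement (possibly a null or empty compound statement) different from the loop
  statement itself.
\<close>

locale imperative_language =
  fixes G :: "('n, 't) grammar"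
    and parse :: "'t program \<Rightarrow> ('n, 't) ptree"
    and S :: "'n set"
    and cfg :: "'t program \<Rightarrow> address pair_pre_digraph"
  assumes grammar: "context_free_grammar G"
    and parse: "unique_locations q \<Longrightarrow> recognized G q \<Longrightarrow> is_parse_tree G q (parse q)"
    and cfg: "unique_locations q \<Longrightarrow> recognized G q \<Longrightarrow> pair_digraph (cfg q)"
    and cfg_nodes: "unique_locations q \<Longrightarrow> recognized G q \<Longrightarrow> pverts (cfg q) = statements S (parse q)"

text \<open>
  Statements of a fragment are identified with statements of the full program by a map \<open>\<iota>\<close> between
  parse tree nodes. A statement and its counterpart need not have the same tokens (the fragment may
  have lost some, and addresses shift), but they have a token, i.e. a location, in common.
  Injectivity is not demanded.
\<close>

definition statement_identification ::
  "'n set \<Rightarrow> ('n, 't) ptree \<Rightarrow> ('n, 't) ptree \<Rightarrow> (address \<Rightarrow> address) \<Rightarrow> bool"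
where
  "statement_identification S pt' pt \<iota> \<longleftrightarrow>
     (\<forall>n\<in>statements S pt'. \<iota> n \<in> statements S pt \<and>
        statement_tokens pt' n \<inter> statement_tokens pt (\<iota> n) \<noteq> {})"

text \<open>
  Paths are vertex walks, which may revisit nodes; acyclic paths are those without repetition.
\<close>

definition ordered_before :: "'a pair_pre_digraph \<Rightarrow> 'a \<Rightarrow> 'a \<Rightarrow> bool" where
  "ordered_before H x\<^sub>1 x\<^sub>2 \<longleftrightarrow>
     (\<exists>\<omega>. vpath \<omega> (with_proj H) \<and> (\<exists>i j. i < j \<and> j < length \<omega> \<and> \<omega> ! i = x\<^sub>1 \<and> \<omega> ! j = x\<^sub>2))"

end

theory Submission
  imports Defs
begin

text \<open>
  Control flow graphs have no loops, so each arc of \<open>cfg s'\<close> is by itself an acyclic path and its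
  endpoints are ordered. The order carries over to \<open>p\<close>, where it is witnessed by a walk between the
  counterparts of the endpoints; joining these walks along a path of \<open>s'\<close> gives the path of \<open>p\<close>.
\<close>

text \<open>Nonempty contiguous pieces of a walk are walks. The form \<open>x # xs @ [y]\<close>
  exposes both ends for later gluing; \<open>i < j\<close> ensures at least one arc.\<close>

lemma vwalk_segment:
  assumes "vwalk \<omega> H" "i < j" "j < length \<omega>"
  shows "\<exists>xs. vwalk (\<omega> ! i # xs @ [\<omega> ! j]) H"
proof -
  have "vwalk (drop i \<omega>) H"
    using assms vwalkI_append_r[of "drop i \<omega>" "take i \<omega>" H] by simp
  then have "vwalk (take (Suc j - i) (drop i \<omega>)) H"
    using assms vwalkI_append_l[of "take (Suc j - i) (drop i \<omega>)" "drop (Suc j - i) (drop i \<omega>)" H]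
    unfolding append_take_drop_id by simp
  moreover have "take (Suc j - i) (drop i \<omega>) = \<omega> ! i # take (j - Suc i) (drop (Suc i) \<omega>) @ [\<omega> ! j]"
  proof -
    \<comment> \<open>\<open>k\<close> counts the vertices strictly between positions
      \<open>i\<close> and \<open>j\<close>, possibly none; they become \<open>xs\<close>.\<close>
    obtain k where k: "j = Suc (i + k)"
      using assms(2) less_iff_Suc_add by blast
    have "drop i \<omega> = \<omega> ! i # drop (Suc i) \<omega>"
      using assms by (intro Cons_nth_drop_Suc[symmetric]) simp
    then have "take (Suc j - i) (drop i \<omega>) = \<omega> ! i # take (Suc k) (drop (Suc i) \<omega>)"
      unfolding k by simp
    also have "take (Suc k) (drop (Suc i) \<omega>) = take k (drop (Suc i) \<omega>) @ [\<omega> ! j]"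
      using assms(3) k by (subst take_Suc_conv_app_nth) simp_all
    finally show ?thesis
      unfolding k by simp
  qed
  ultimately show ?thesis
    by auto
qed

text \<open>Distinctness of the path is given up here, since walks glued one after another may
  revisit nodes.\<close>

lemma ordered_before_vwalk:
  assumes "ordered_before H x y"
  shows "\<exists>xs. vwalk (x # xs @ [y]) (with_proj H)"
  using assms vwalk_segment unfolding ordered_before_def vpath_def by blast

text \<open>Absence of loops makes \<open>u\<close> and \<open>v\<close> differ, so
  \<open>[u, v]\<close> is distinct and thus a \<open>vpath\<close>.\<close>

lemma (in pair_digraph) arc_ordered_before:
  assumes "(u, v) \<in> parcs G"
  shows "ordered_before G u v"
proof -
  have "vpath [u, v] (with_proj G)"
    using assms arc_fst_in_verts arc_snd_in_verts pair_no_loops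
    by (fastforce simp: vpath_def vwalk_def)
  then show ?thesis
    unfolding ordered_before_def by (intro exI[of _ "[u, v]"] conjI exI[of _ 0] exI[of _ 1]) auto
qed

text \<open>Induction along \<open>t\<close>: each arc becomes a walk between the images of its
  ends, and \<open>subseq\<close> skips the inserted vertices. The clause on \<open>hd\<close> is
  the invariant that allows gluing the next walk in front.\<close>

lemma vwalk_lift:
  assumes "vwalk t H"
    and verts: "\<And>u. u \<in> verts H \<Longrightarrow> f u \<in> verts K"
    and arcs: "\<And>u v. (u, v) \<in> arcs_ends H \<Longrightarrow> \<exists>xs. vwalk (f u # xs @ [f v]) K"
  shows "\<exists>\<omega>. vwalk \<omega> K \<and> hd \<omega> = f (hd t) \<and> subseq (map f t) \<omega>"
  using assms(1)
proof (induction t)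
  case (Base u)
  then show ?case
    using verts by (intro exI[of _ "[f u]"]) auto
next
  case (Cons u v es)
  then obtain \<omega> where \<omega>: "vwalk \<omega> K" "hd \<omega> = f v" "subseq (map f (v # es)) \<omega>"
    by auto
  from arcs[OF Cons(1)] obtain xs where xs: "vwalk (f u # xs @ [f v]) K"
    by blast
  \<comment> \<open>The join drops the head of the second walk, which is \<open>f v\<close>, already
    the last entry of the first.\<close>
  have "(f u # xs @ [f v]) \<oplus> \<omega> = f u # xs @ \<omega>"
    using \<omega>(1,2) by (cases \<omega>) (auto simp: vwalk_join_def vwalk_def)
  then have "vwalk (f u # xs @ \<omega>) K"
    using vwalk_joinI_vwalk'[OF xs \<omega>(1)] \<omega>(2) by simp
  then show ?case
    using \<omega>(3) subseq_drop_many[of _ \<omega> xs] by (intro exI[of _ "f u # xs @ \<omega>"]) auto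
qed

theorem theorem2:
  fixes G :: "('n, 't) grammar"
    and parse :: "'t program \<Rightarrow> ('n, 't) ptree"
    and S :: "'n set"
    and cfg :: "'t program \<Rightarrow> address pair_pre_digraph"
    and p s s' :: "'t program"
    and \<iota> :: "address \<Rightarrow> address"
  assumes "imperative_language G parse S cfg"
    and "unique_locations p" and "recognized G p"
    and "subseq s p"
    and "patched_program G parse p s s'"
    and "statement_identification S (parse s') (parse p) \<iota>"
    and "\<And>n\<^sub>1 n\<^sub>2. n\<^sub>1 \<in> statements S (parse s') \<Longrightarrow> n\<^sub>2 \<in> statements S (parse s') \<Longrightarrow>
           ordered_before (cfg s') n\<^sub>1 n\<^sub>2 \<longleftrightarrow> ordered_before (cfg p) (\<iota> n\<^sub>1) (\<iota> n\<^sub>2)"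
  shows "\<forall>t. vwalk t (with_proj (cfg s')) \<longrightarrow>
           (\<exists>\<omega>. vwalk \<omega> (with_proj (cfg p)) \<and> subseq (map \<iota> t) \<omega>)"
proof -
  interpret imperative_language G parse S cfg
    by fact
  have s': "subseq s' p" "recognized G s'"
    using assms(5) by (auto simp: patched_program_def patch_candidate_def)
  \<comment> \<open>Deleting tokens cannot repeat a location, so the assumptions on the language
    apply to \<open>s'\<close> too.\<close>
  then have loc: "unique_locations s'"
    using assms(2) subseq_map[of s' p fst] by (metis unique_locations_def subseq_conv_nths distinct_nthsI)
  interpret cfg': pair_digraph "cfg s'"
    by (rule cfg) fact+
  note nodes' = cfg_nodes[OF loc s'(2)] and nodes = cfg_nodes[OF assms(2,3)]
  show ?thesis
  proof (intro allI impI)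
    fix t assume t: "vwalk t (with_proj (cfg s'))"
    have "\<exists>\<omega>. vwalk \<omega> (with_proj (cfg p)) \<and> hd \<omega> = \<iota> (hd t) \<and> subseq (map \<iota> t) \<omega>"
    proof (rule vwalk_lift[OF t])
      fix u assume "u \<in> verts (with_proj (cfg s'))"
      then show "\<iota> u \<in> verts (with_proj (cfg p))"
        using assms(6) nodes' nodes by (simp add: statement_identification_def)
    next
      fix u v assume "(u, v) \<in> arcs_ends (with_proj (cfg s'))"
      then have uv: "(u, v) \<in> parcs (cfg s')"
        by simp
      \<comment> \<open>The agreement of orders speaks of statements, and these are exactly the
        vertices of \<open>cfg s'\<close>.\<close>
      then have "u \<in> statements S (parse s')" "v \<in> statements S (parse s')"
        using cfg'.arc_fst_in_verts[OF uv] cfg'.arc_snd_in_verts[OF uv] nodes' by simp_all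
      then show "\<exists>xs. vwalk (\<iota> u # xs @ [\<iota> v]) (with_proj (cfg p))"
        using assms(7) cfg'.arc_ordered_before[OF uv] by (intro ordered_before_vwalk) simp
    qed
    then show "\<exists>\<omega>. vwalk \<omega> (with_proj (cfg p)) \<and> subseq (map \<iota> t) \<omega>"
      by blast
  qed
qed

end
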